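(* For each of the following three questions there is no algorithm that, given any constructive linear programming problem (CLPP) whose set of allowable plans is nonempty, always decides the question: (1) whether the set of allowable plans is bounded; (2) whether the cost function is bounded on the set of allowable plans; (3) whether there exists an optimal plan.
   Context: "Algorithm" means Turing machine (partial recursive function); algorithms are encoded by natural numbers, and an algorithm applied to other algorithms receives their codes. To decide a property means to terminate on every input of the given kind and output $1$ or $0$ according to whether the property holds or not. A constructive real number (CRN) is a pair of algorithms $(F,R)$, where $F$ transforms every natural number into a rational number, $R$ transforms every positive rational number into a natural number, and for every rational $\varepsilon>0$ and all $m,n>R(\varepsilon)$ one has $|F(m)-F(n)|<\varepsilon$. If $x=(F,R)$, write $x(n)=F(n)$. For CRNs $x,y$: $x=y$ means that for every rational $\varepsilon>0$ one can algorithmically produce a natural $M$ such that $|x(m)-y(n)|<\varepsilon$ for all $m,n>M$; $x<y$ means that one can produce a rational $\varepsilon>0$ and a natural $M$ such that $y(m)>x(n)+\varepsilon$ for all $m,n>M$; $x\le y$ means that for every rational $\varepsilon>0$ one can algorithmically produce a natural $M$ such that $y(m)>x(n)-\varepsilon$ for all $m,n>M$. Arithmetic operations on CRNs are the natural ones. An algorithm receiving a CRN as input receives the codes of the pair $(F,R)$; algorithms on CRNs are not required to give equal results for equal CRNs. A constructive linear programming problem (CLPP) is a problem of maximizing or minimizing a linear function (the cost function) of finitely many variables subject to finitely many linear equations and nonstrict linear inequalities, all of whose coefficients and constants are CRNs; it is given by (the codes of) these CRNs. A plan is a tuple of CRNs, one for each variable. A plan is allowable if it satisfies all the constraints. An allowable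 plan is optimal if the cost function attains at it its maximum (respectively minimum) over all allowable plans. The set of allowable plans is nonempty if it is impossible that no allowable plan exists, and it is bounded if there is a rational number bounding the absolute values of all coordinates of all allowable plans. The cost function is bounded if its values on allowable plans are bounded above by a rational number (for a maximization problem), respectively bounded below (for a minimization problem). *)

theory Defs
  imports Complex_Main "HOL-Library.Nat_Bijection"
begin

section \<open>Algorithms\<close>

datatype recf =
    Zero
  | Succ
  | Proj nat
  | Comp recf "recf list"
  | PrimRec recf recf
  | Mu recf

text \<open>
  \<open>computes f xs y\<close>: the partial recursive function \<open>f\<close> is defined on the argument tuple \<open>xs\<close> and
  has value \<open>y\<close> there.  The recursion variable of \<open>PrimRec\<close> and the search variable of \<open>Mu\<close>
  come first.  Arities are implicit: \<open>f\<close> is simply undefined on tuples that do not fit.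
\<close>

inductive computes :: "recf \<Rightarrow> nat list \<Rightarrow> nat \<Rightarrow> bool" where
  computes_Zero: "computes Zero xs 0"
| computes_Succ: "computes Succ [x] (Suc x)"
| computes_Proj: "i < length xs \<Longrightarrow> computes (Proj i) xs (xs ! i)"
| computes_Comp: "length ys = length gs \<Longrightarrow> (\<forall>i<length gs. computes (gs ! i) xs (ys ! i)) \<Longrightarrow>
    computes f ys z \<Longrightarrow> computes (Comp f gs) xs z"
| computes_PrimRec_0: "computes f xs y \<Longrightarrow> computes (PrimRec f g) (0 # xs) y"
| computes_PrimRec_Suc: "computes (PrimRec f g) (n # xs) r \<Longrightarrow> computes g (n # r # xs) y \<Longrightarrow>
    computes (PrimRec f g) (Suc n # xs) y"
| computes_Mu: "computes f (n # xs) 0 \<Longrightarrow> (\<forall>i<n. \<exists>y>0. computes f (i # xs) y) \<Longrightarrow>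
    computes (Mu f) xs n"

inductive_cases computes_ZeroE: "computes Zero xs y"
inductive_cases computes_SuccE: "computes Succ xs y"
inductive_cases computes_ProjE: "computes (Proj i) xs y"
inductive_cases computes_CompE: "computes (Comp f gs) xs y"
inductive_cases computes_PrimRecE: "computes (PrimRec f g) xs y"
inductive_cases computes_MuE: "computes (Mu f) xs y"

lemma computes_deterministic:
  "computes f xs y \<Longrightarrow> computes f xs z \<Longrightarrow> y = z"
proof (induction arbitrary: z rule: computes.induct)
  case (computes_Comp ys gs xs f w)
  from computes_Comp.prems obtain ys' where ys':
    "length ys' = length gs" "\<forall>i<length gs. computes (gs ! i) xs (ys' ! i)" "computes f ys' z"
    by (rule computes_CompE) auto
  have "ys = ys'"
    using computes_Comp.hyps computes_Comp.IH ys' by (intro nth_equalityI) auto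
  then show ?case
    using computes_Comp.IH ys' by auto
next
  case (computes_Mu f n xs)
  from computes_Mu.prems have z: "computes f (z # xs) 0" "\<forall>i<z. \<exists>y>0. computes f (i # xs) y"
    by (auto elim: computes_MuE)
  have "\<not> z < n"
    using computes_Mu.IH z(1) by force
  moreover have "\<not> n < z"
    using computes_Mu.IH z(2) by force
  ultimately show ?case by simp
qed (blast elim: computes_ZeroE computes_SuccE computes_ProjE computes_PrimRecE)+

fun recf_encode :: "recf \<Rightarrow> nat" where
  "recf_encode Zero = prod_encode (0, 0)"
| "recf_encode Succ = prod_encode (1, 0)"
| "recf_encode (Proj i) = prod_encode (2, i)"
| "recf_encode (Comp f gs) =
    prod_encode (3, prod_encode (recf_encode f, list_encode (map recf_encode gs)))"
| "recf_encode (PrimRec f g) = prod_encode (4, prod_encode (recf_encode f, recf_encode g))"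
| "recf_encode (Mu f) = prod_encode (5, recf_encode f)"

lemma recf_encode_inject: "recf_encode f = recf_encode g \<Longrightarrow> f = g"
proof (induction f arbitrary: g)
  case (Comp f gs)
  then obtain f' gs' where g: "g = Comp f' gs'"
    by (cases g) auto
  have "map recf_encode gs = map recf_encode gs'"
    using Comp.prems g by (auto dest: inj_onD[OF inj_list_encode])
  then have "gs = gs'"
    using Comp.IH(2) by (auto intro!: nth_equalityI dest: map_eq_imp_length_eq simp: list_eq_iff_nth_eq)
  then show ?case
    using Comp g by auto
next
  case Zero then show ?case by (cases g) auto
next
  case Succ then show ?case by (cases g) auto
next
  case (Proj i) then show ?case by (cases g) auto
next
  case (PrimRec f h) then show ?case by (cases g) auto
next
  case (Mu f) then show ?case by (cases g) auto
qed


section \<open>Constructive real numbers\<close>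

text \<open>Rational numbers are given to and returned by algorithms in lowest terms.\<close>

definition rat_encode :: "rat \<Rightarrow> nat" where
  "rat_encode q = (case quotient_of q of (n, d) \<Rightarrow> prod_encode (int_encode n, nat d))"

lemma inj_rat_encode: "inj rat_encode"
proof (rule injI)
  fix p q :: rat
  assume eq: "rat_encode p = rat_encode q"
  obtain a b c d where pq: "quotient_of p = (a, b)" "quotient_of q = (c, d)"
    by fastforce
  have "int_encode a = int_encode c" "nat b = nat d" "b > 0" "d > 0"
    using eq pq quotient_of_denom_pos by (auto simp: rat_encode_def)
  then have "quotient_of p = quotient_of q"
    using pq by (auto dest: inj_onD[OF inj_int_encode])
  then show "p = q"
    by (simp add: quotient_of_inject_eq)
qed

text \<open>The pair \<open>(F, R)\<close> of an approximating algorithm and a convergence regulator.\<close>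

type_synonym crn = "recf \<times> recf"

definition approx :: "crn \<Rightarrow> nat \<Rightarrow> rat" where
  "approx x n = (THE q. computes (fst x) [n] (rat_encode q))"

definition is_crn :: "crn \<Rightarrow> bool" where
  "is_crn x \<longleftrightarrow>
    (\<forall>n. \<exists>q. computes (fst x) [n] (rat_encode q)) \<and>
    (\<forall>\<epsilon>>0. \<exists>N. computes (snd x) [rat_encode \<epsilon>] N \<and>
      (\<forall>m>N. \<forall>n>N. \<bar>approx x m - approx x n\<bar> < \<epsilon>))"

lemma approx_eqI: "computes (fst x) [n] (rat_encode q) \<Longrightarrow> approx x n = q"
  unfolding approx_def
  by (rule the_equality) (auto dest: computes_deterministic injD[OF inj_rat_encode])

text \<open>
  Equality and order of constructive reals refer only to the approximating sequences, and the
  arithmetic operations act on these termwise.  So the relations are stated for sequences of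
  rationals; regulators of sums and products are not needed.  The algorithm \<open>A\<close> is the one
  that produces the index \<open>M\<close> from \<open>\<epsilon>\<close>.
\<close>

definition crn_eq :: "(nat \<Rightarrow> rat) \<Rightarrow> (nat \<Rightarrow> rat) \<Rightarrow> bool" where
  "crn_eq x y \<longleftrightarrow> (\<exists>A. \<forall>\<epsilon>>0. \<exists>M. computes A [rat_encode \<epsilon>] M \<and>
    (\<forall>m>M. \<forall>n>M. \<bar>x m - y n\<bar> < \<epsilon>))"

definition crn_le :: "(nat \<Rightarrow> rat) \<Rightarrow> (nat \<Rightarrow> rat) \<Rightarrow> bool" where
  "crn_le x y \<longleftrightarrow> (\<exists>A. \<forall>\<epsilon>>0. \<exists>M. computes A [rat_encode \<epsilon>] M \<and>
    (\<forall>m>M. \<forall>n>M. y m > x n - \<epsilon>))"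

definition linear_form :: "crn list \<Rightarrow> crn list \<Rightarrow> nat \<Rightarrow> rat" where
  "linear_form a x = (\<lambda>n. \<Sum>j<length x. approx (a ! j) n * approx (x ! j) n)"


section \<open>Constructive linear programming problems\<close>

datatype objective = Maximize | Minimize

datatype comparison = Equal | LessEq | GreaterEq

text \<open>
  The number of variables is the length of the list of cost coefficients.  A constraint
  consists of its coefficients, its relation symbol and its right-hand side.
\<close>

datatype clpp = CLPP
  (objective: objective)
  (cost: "crn list")
  (constraints: "(crn list \<times> comparison \<times> crn) list")

definition is_clpp :: "clpp \<Rightarrow> bool" where
  "is_clpp P \<longleftrightarrow>
    (\<forall>c\<in>set (cost P). is_crn c) \<and>
    (\<forall>(a, r, b)\<in>set (constraints P).
      length a = length (cost P) \<and> (\<forall>c\<in>set a. is_crn c) \<and> is_crn b)"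

definition is_plan :: "clpp \<Rightarrow> crn list \<Rightarrow> bool" where
  "is_plan P x \<longleftrightarrow> length x = length (cost P) \<and> (\<forall>c\<in>set x. is_crn c)"

fun satisfies :: "crn list \<Rightarrow> crn list \<times> comparison \<times> crn \<Rightarrow> bool" where
  "satisfies x (a, Equal, b) \<longleftrightarrow> crn_eq (linear_form a x) (approx b)"
| "satisfies x (a, LessEq, b) \<longleftrightarrow> crn_le (linear_form a x) (approx b)"
| "satisfies x (a, GreaterEq, b) \<longleftrightarrow> crn_le (approx b) (linear_form a x)"

definition allowable :: "clpp \<Rightarrow> crn list \<Rightarrow> bool" where
  "allowable P x \<longleftrightarrow> is_plan P x \<and> (\<forall>c\<in>set (constraints P). satisfies x c)"

definition plans_nonempty :: "clpp \<Rightarrow> bool" where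
  "plans_nonempty P \<longleftrightarrow> \<not> (\<nexists>x. allowable P x)"

definition plans_bounded :: "clpp \<Rightarrow> bool" where
  "plans_bounded P \<longleftrightarrow> (\<exists>B::rat. \<forall>x. allowable P x \<longrightarrow>
    (\<forall>c\<in>set x. crn_le (\<lambda>n. \<bar>approx c n\<bar>) (\<lambda>_. B)))"

definition cost_bounded :: "clpp \<Rightarrow> bool" where
  "cost_bounded P \<longleftrightarrow> (\<exists>B::rat. \<forall>x. allowable P x \<longrightarrow>
    (case objective P of
      Maximize \<Rightarrow> crn_le (linear_form (cost P) x) (\<lambda>_. B)
    | Minimize \<Rightarrow> crn_le (\<lambda>_. B) (linear_form (cost P) x)))"

definition optimal :: "clpp \<Rightarrow> crn list \<Rightarrow> bool" where
  "optimal P x \<longleftrightarrow> allowable P x \<and> (\<forall>y. allowable P y \<longrightarrow>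
    (case objective P of
      Maximize \<Rightarrow> crn_le (linear_form (cost P) y) (linear_form (cost P) x)
    | Minimize \<Rightarrow> crn_le (linear_form (cost P) x) (linear_form (cost P) y)))"

definition has_optimal_plan :: "clpp \<Rightarrow> bool" where
  "has_optimal_plan P \<longleftrightarrow> (\<exists>x. optimal P x)"


section \<open>Decision algorithms\<close>

fun crn_encode :: "crn \<Rightarrow> nat" where
  "crn_encode (F, R) = prod_encode (recf_encode F, recf_encode R)"

fun objective_encode :: "objective \<Rightarrow> nat" where
  "objective_encode Maximize = 0"
| "objective_encode Minimize = 1"

fun comparison_encode :: "comparison \<Rightarrow> nat" where
  "comparison_encode Equal = 0"
| "comparison_encode LessEq = 1"
| "comparison_encode GreaterEq = 2"

fun constraint_encode :: "crn list \<times> comparison \<times> crn \<Rightarrow> nat" where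
  "constraint_encode (a, r, b) =
    prod_encode (list_encode (map crn_encode a), prod_encode (comparison_encode r, crn_encode b))"

fun clpp_encode :: "clpp \<Rightarrow> nat" where
  "clpp_encode (CLPP d c cs) =
    prod_encode (objective_encode d,
      prod_encode (list_encode (map crn_encode c), list_encode (map constraint_encode cs)))"

lemma inj_crn_encode: "inj crn_encode"
  by (rule injI) (auto dest: recf_encode_inject elim!: crn_encode.elims)

lemma inj_constraint_encode: "inj constraint_encode"
proof (rule injI)
  fix x y
  assume eq: "constraint_encode x = constraint_encode y"
  obtain a r b a' r' b' where xy: "x = (a, r, b)" "y = (a', r', b')"
    by (metis prod_cases3)
  have "map crn_encode a = map crn_encode a'" "comparison_encode r = comparison_encode r'"
      "crn_encode b = crn_encode b'"
    using eq xy by (auto dest: inj_onD[OF inj_list_encode])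
  then show "x = y"
    using xy inj_crn_encode by (cases r; cases r') (auto dest: injD simp: inj_map_eq_map)
qed

lemma inj_clpp_encode: "inj clpp_encode"
proof (rule injI)
  fix P Q
  assume eq: "clpp_encode P = clpp_encode Q"
  obtain d c cs d' c' cs' where PQ: "P = CLPP d c cs" "Q = CLPP d' c' cs'"
    by (metis clpp.exhaust)
  have "objective_encode d = objective_encode d'" "map crn_encode c = map crn_encode c'"
      "map constraint_encode cs = map constraint_encode cs'"
    using eq PQ by (auto dest: inj_onD[OF inj_list_encode])
  then show "P = Q"
    using PQ inj_crn_encode inj_constraint_encode
    by (cases d; cases d') (auto simp: inj_map_eq_map)
qed

text \<open>
  Nothing is required of \<open>D\<close> on inputs that do not encode a problem with a nonempty set of
  allowable plans.
\<close>

definition decides :: "recf \<Rightarrow> (clpp \<Rightarrow> bool) \<Rightarrow> bool" where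
  "decides D Q \<longleftrightarrow> (\<forall>P. is_clpp P \<and> plans_nonempty P \<longrightarrow>
    computes D [clpp_encode P] (if Q P then 1 else 0))"

end

theory Submission imports Defs begin

text \<open>
  For a constructive real \<open>x \<ge> 0\<close>, maximize \<open>y\<close> subject to \<open>x * y = 0\<close>. If \<open>x = 0\<close>, every \<open>y\<close> is
  allowable and all three questions have a negative answer; if \<open>x > 0\<close>, only \<open>y = 0\<close> is allowable
  and all three answers are positive. So a decision algorithm \<open>D\<close> would decide whether \<open>x = 0\<close>. Using
  self-reference, let \<open>x\<close> run \<open>D\<close> on its own problem: \<open>x n = 1 / (t + 1)\<close>, where \<open>t\<close> is the first
  stage at which \<open>D\<close> is seen to return \<open>0\<close>, or \<open>n\<close> if this does not happen before stage \<open>n\<close>. Then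
  \<open>x > 0\<close> if and only if \<open>D\<close> returns \<open>0\<close>, so \<open>D\<close> is wrong about this problem. No universal machine is needed
  to run \<open>D\<close> in stages, since \<open>D\<close> is fixed: induction on its structure suffices.
\<close>

section \<open>Total recursive functions\<close>

text \<open>A fixed arity is attached because \<open>computes\<close> leaves arities implicit;
  functions of whole lists let the closure rules apply to arbitrary terms in
  \<open>xs\<close>.\<close>

definition recursive :: "nat \<Rightarrow> (nat list \<Rightarrow> nat) \<Rightarrow> bool" where
  "recursive k g \<longleftrightarrow> (\<exists>T. \<forall>xs. length xs = k \<longrightarrow> computes T xs (g xs))"

lemma recursive_cong:
  assumes "recursive k g" "\<And>xs. length xs = k \<Longrightarrow> g xs = h xs"
  shows "recursive k h"
  using assms by (metis recursive_def)

text \<open>The map \<open>\<phi>\<close> packs the inner functions into one list; a suitable choice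
  also permutes, duplicates or drops arguments.\<close>

lemma recursive_compose:
  assumes h: "recursive m h"
    and len: "\<And>xs. length xs = k \<Longrightarrow> length (\<phi> xs) = m"
    and comp: "\<And>j. j < m \<Longrightarrow> recursive k (\<lambda>xs. \<phi> xs ! j)"
  shows "recursive k (\<lambda>xs. h (\<phi> xs))"
proof -
  obtain H where H: "\<And>xs. length xs = m \<Longrightarrow> computes H xs (h xs)"
    using h by (auto simp: recursive_def)
  obtain G where G: "\<And>j xs. j < m \<Longrightarrow> length xs = k \<Longrightarrow> computes (G j) xs (\<phi> xs ! j)"
    using comp unfolding recursive_def by metis
  have "computes (Comp H (map G [0..<m])) xs (h (\<phi> xs))" if "length xs = k" for xs
    by (rule computes_Comp[where ys = "\<phi> xs"]) (use that H G len in auto)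
  then show ?thesis by (auto simp: recursive_def)
qed

lemma recursive_nth: "i < k \<Longrightarrow> recursive k (\<lambda>xs. xs ! i)"
  by (auto simp: recursive_def intro!: exI[of _ "Proj i"] computes_Proj)

lemma recursive_Suc:
  assumes "recursive k g"
  shows "recursive k (\<lambda>xs. Suc (g xs))"
proof -
  have "recursive 1 (\<lambda>xs. Suc (xs ! 0))"
    unfolding recursive_def
    by (rule exI[of _ Succ]) (auto simp: length_Suc_conv intro: computes_Succ)
  from recursive_compose[OF this, of k "\<lambda>xs. [g xs]"] show ?thesis
    using assms by simp
qed

lemma recursive_const: "recursive k (\<lambda>_. n)"
proof (induction n)
  case 0
  show ?case by (auto simp: recursive_def intro: computes_Zero)
next
  case (Suc n)
  then show ?case by (rule recursive_Suc)
qed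

lemma recursive_rec_nat:
  assumes "recursive k f" "recursive (Suc (Suc k)) g"
  shows "recursive (Suc k) (\<lambda>xs. rec_nat (f (tl xs)) (\<lambda>i r. g (i # r # tl xs)) (hd xs))"
proof -
  obtain F where F: "\<And>xs. length xs = k \<Longrightarrow> computes F xs (f xs)"
    using assms by (auto simp: recursive_def)
  obtain G where G: "\<And>xs. length xs = Suc (Suc k) \<Longrightarrow> computes G xs (g xs)"
    using assms by (auto simp: recursive_def)
  have "computes (PrimRec F G) (n # xs) (rec_nat (f xs) (\<lambda>i r. g (i # r # xs)) n)"
    if "length xs = k" for n xs
    by (induction n) (use that F G in \<open>auto intro: computes_PrimRec_0 computes_PrimRec_Suc\<close>)
  then show ?thesis
    unfolding recursive_def by (intro exI[of _ "PrimRec F G"]) (auto simp: length_Suc_conv)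
qed

lemma recursive_Least:
  assumes "recursive (Suc k) p" "\<And>xs. length xs = k \<Longrightarrow> \<exists>n. p (n # xs) = 0"
  shows "recursive k (\<lambda>xs. LEAST n. p (n # xs) = 0)"
proof -
  obtain G where G: "\<And>xs. length xs = Suc k \<Longrightarrow> computes G xs (p xs)"
    using assms by (auto simp: recursive_def)
  have "computes (Mu G) xs (LEAST n. p (n # xs) = 0)" if "length xs = k" for xs
  proof (rule computes_Mu)
    have "p ((LEAST n. p (n # xs) = 0) # xs) = 0"
      using assms(2)[OF that] by (rule LeastI_ex)
    then show "computes G ((LEAST n. p (n # xs) = 0) # xs) 0"
      using G[of "(LEAST n. p (n # xs) = 0) # xs"] that by simp
    show "\<forall>i<LEAST n. p (n # xs) = 0. \<exists>y>0. computes G (i # xs) y"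
    proof (intro allI impI)
      fix i assume "i < (LEAST n. p (n # xs) = 0)"
      then have "0 < p (i # xs)" using not_less_Least by blast
      then show "\<exists>y>0. computes G (i # xs) y" using G[of "i # xs"] that by auto
    qed
  qed
  then show ?thesis by (auto simp: recursive_def)
qed

text \<open>A more flexible form of primitive recursion: the number of steps is any recursive
  function. In the step, counter and previous value precede the parameters, hence
  \<open>drop 2\<close>.\<close>

lemma recursive_rec:
  assumes n: "recursive k n" and f: "recursive k f"
    and g: "recursive (Suc (Suc k)) (\<lambda>ys. g (ys ! 0) (ys ! 1) (drop 2 ys))"
  shows "recursive k (\<lambda>xs. rec_nat (f xs) (\<lambda>i r. g i r xs) (n xs))"
proof -
  have "recursive k (\<lambda>xs. (n xs # xs) ! j)" if "j < Suc k" for j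
    using that n by (cases j) (auto intro: recursive_nth)
  from recursive_compose[where \<phi> = "\<lambda>xs. n xs # xs", OF recursive_rec_nat[OF f g] _ this]
  show ?thesis by (simp add: numeral_2_eq_2)
qed

lemma recursive_drop:
  assumes "recursive k f"
  shows "recursive (m + k) (\<lambda>ys. f (drop m ys))"
  by (rule recursive_compose[OF assms], simp)
    (rule recursive_cong[OF recursive_nth], auto)

lemma recursive_drop2:
  assumes "recursive k f"
  shows "recursive (Suc (Suc k)) (\<lambda>ys. f (drop 2 ys))"
  using recursive_drop[OF assms, of 2] by simp

section \<open>Truncated arithmetic, case distinction and pairing\<close>

lemma recursive_pred:
  assumes "recursive k f"
  shows "recursive k (\<lambda>xs. f xs - 1)"
proof -
  have "recursive k (\<lambda>xs. rec_nat 0 (\<lambda>i r. i) (f xs))"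
    by (rule recursive_rec[OF assms recursive_const]) (simp add: recursive_nth)
  moreover have "rec_nat 0 (\<lambda>i r. i) n = n - 1" for n :: nat
    by (cases n) auto
  ultimately show ?thesis by simp
qed

lemma recursive_diff:
  assumes "recursive k f" "recursive k g"
  shows "recursive k (\<lambda>xs. f xs - g xs)"
proof -
  have "recursive k (\<lambda>xs. rec_nat (f xs) (\<lambda>i r. r - 1) (g xs))"
    by (rule recursive_rec[OF assms(2,1)]) (intro recursive_pred recursive_nth, simp)
  moreover have "rec_nat m (\<lambda>i r. r - 1) n = m - n" for m n :: nat
    by (induction n) auto
  ultimately show ?thesis by simp
qed

lemma recursive_add:
  assumes "recursive k f" "recursive k g"
  shows "recursive k (\<lambda>xs. f xs + g xs)"
proof -
  have "recursive k (\<lambda>xs. rec_nat (f xs) (\<lambda>i r. Suc r) (g xs))"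
    by (rule recursive_rec[OF assms(2,1)]) (intro recursive_Suc recursive_nth, simp)
  moreover have "rec_nat m (\<lambda>i. Suc) n = m + n" for m n :: nat
    by (induction n) auto
  ultimately show ?thesis by simp
qed

lemma recursive_if:
  assumes "recursive k c" "recursive k f" "recursive k g"
  shows "recursive k (\<lambda>xs. if c xs = 0 then f xs else g xs)"
proof -
  have "recursive k (\<lambda>xs. rec_nat (f xs) (\<lambda>i r. g xs) (c xs))"
    by (rule recursive_rec[OF assms(1,2)]) (rule recursive_drop2[OF assms(3)])
  moreover have "rec_nat m (\<lambda>i r. m') n = (if n = 0 then m else m')" for m m' n :: nat
    by (cases n) auto
  ultimately show ?thesis by simp
qed

lemma recursive_prod_encode:
  assumes "recursive k f" "recursive k g"
  shows "recursive k (\<lambda>xs. prod_encode (f xs, g xs))"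
proof -
  \<comment> \<open>Cantor pairing is \<open>triangle (m + n) + m\<close>; the recursion sums up the
    triangular number.\<close>
  have "recursive k (\<lambda>xs. rec_nat 0 (\<lambda>i r. r + Suc i) (f xs + g xs))"
    by (rule recursive_rec)
      (use assms in \<open>auto intro!: recursive_add recursive_const recursive_Suc recursive_nth simp del: add_Suc_right\<close>)
  moreover have "rec_nat 0 (\<lambda>i r. r + Suc i) n = triangle n" for n
    by (induction n) auto
  ultimately have "recursive k (\<lambda>xs. triangle (f xs + g xs))" by simp
  then show ?thesis
    using assms(1) by (simp add: prod_encode_def recursive_add)
qed

lemmas recursive_intros = recursive_const recursive_Suc recursive_nth recursive_pred
  recursive_diff recursive_add recursive_if recursive_prod_encode

section \<open>Evaluation with bounded search\<close>

text \<open>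
  The value \<open>0\<close> means that no result was found and \<open>Suc y\<close> that the result is \<open>y\<close>. The
  bound \<open>t\<close> limits only the unbounded searches; everything else terminates anyway.
\<close>

fun bounded_eval :: "recf \<Rightarrow> nat \<Rightarrow> nat list \<Rightarrow> nat" where
  "bounded_eval Zero t xs = 1"
| "bounded_eval Succ t xs = (if length xs = 1 then Suc (Suc (xs ! 0)) else 0)"
| "bounded_eval (Proj i) t xs = (if i < length xs then Suc (xs ! i) else 0)"
| "bounded_eval (Comp f gs) t xs =
    (if \<forall>g\<in>set gs. bounded_eval g t xs \<noteq> 0
     then bounded_eval f t (map (\<lambda>g. bounded_eval g t xs - 1) gs) else 0)"
| "bounded_eval (PrimRec f g) t xs =
    (if xs = [] then 0
     else rec_nat (bounded_eval f t (tl xs))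
       (\<lambda>i r. if r = 0 then 0 else bounded_eval g t (i # (r - 1) # tl xs)) (hd xs))"
| "bounded_eval (Mu f) t xs =
    (let n = LEAST n. t \<le> n \<or> bounded_eval f t (n # xs) \<le> 1
     in if n < t \<and> bounded_eval f t (n # xs) = 1 then Suc n else 0)"

text \<open>A nonzero value forces every subcomputation it depends on to have succeeded, so
  structural induction on \<open>f\<close> rebuilds the derivation.\<close>

lemma bounded_eval_sound: "bounded_eval f t xs = Suc y \<Longrightarrow> computes f xs y"
proof (induction f arbitrary: xs y)
  case Zero
  then show ?case by (auto intro: computes_Zero)
next
  case Succ
  then show ?case by (auto simp: length_Suc_conv intro: computes_Succ split: if_splits)
next
  case (Proj i)
  then show ?case by (auto intro: computes_Proj split: if_splits)
next
  case (Comp f gs)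
  from Comp.prems have nz: "\<forall>g\<in>set gs. bounded_eval g t xs \<noteq> 0"
    and f: "bounded_eval f t (map (\<lambda>g. bounded_eval g t xs - 1) gs) = Suc y"
    by (auto split: if_splits)
  show ?case
  proof (rule computes_Comp)
    show "computes f (map (\<lambda>g. bounded_eval g t xs - 1) gs) y"
      using Comp.IH(1) f .
    show "\<forall>i<length gs. computes (gs ! i) xs (map (\<lambda>g. bounded_eval g t xs - 1) gs ! i)"
      using nz by (auto intro!: Comp.IH(2))
  qed simp
next
  case (PrimRec f g)
  from PrimRec.prems obtain n zs where xs: "xs = n # zs"
    by (cases xs) auto
  have "computes (PrimRec f g) (n # zs) y"
    if "rec_nat (bounded_eval f t zs)
      (\<lambda>i r. if r = 0 then 0 else bounded_eval g t (i # (r - 1) # zs)) n = Suc y" for y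
    using that
  proof (induction n arbitrary: y)
    case 0
    then show ?case by (auto intro: computes_PrimRec_0 PrimRec.IH)
  next
    case (Suc n)
    let ?r = "rec_nat (bounded_eval f t zs)
      (\<lambda>i r. if r = 0 then 0 else bounded_eval g t (i # (r - 1) # zs)) n"
    \<comment> \<open>Failure propagates: had the previous value been 0, the next would be 0
      too.\<close>
    from Suc.prems obtain r where r: "?r = Suc r"
      by (cases ?r) auto
    with Suc.prems have "bounded_eval g t (n # r # zs) = Suc y" by simp
    then show ?case
      using Suc.IH[OF r] by (auto intro: computes_PrimRec_Suc PrimRec.IH)
  qed
  then show ?case using PrimRec.prems by (simp add: xs cong: if_cong)
next
  case (Mu f)
  \<comment> \<open>The search stops at the bound, at a failed evaluation (0) or at a zero of
    \<open>f\<close> (1); only the last is a success.\<close>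
  let ?P = "\<lambda>n. t \<le> n \<or> bounded_eval f t (n # xs) \<le> 1"
  have y: "y = (LEAST n. ?P n)" "y < t" "bounded_eval f t (y # xs) = Suc 0"
    using Mu.prems by (auto simp: Let_def split: if_splits)
  show ?case
  proof (rule computes_Mu)
    show "computes f (y # xs) 0" using y(3) by (rule Mu.IH)
    show "\<forall>i<y. \<exists>z>0. computes f (i # xs) z"
    proof (intro allI impI)
      fix i assume "i < y"
      then have "\<not> ?P i" using y(1) not_less_Least by blast
      then obtain z where "bounded_eval f t (i # xs) = Suc z" "z > 0"
        by (cases "bounded_eval f t (i # xs)") auto
      then show "\<exists>z>0. computes f (i # xs) z" using Mu.IH by blast
    qed
  qed
qed

text \<open>Success for all large bounds lets finitely many subcomputations share one bound, so
  monotonicity in \<open>t\<close> need not be shown.\<close>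

lemma bounded_eval_complete:
  "computes f xs y \<Longrightarrow> eventually (\<lambda>t. bounded_eval f t xs = Suc y) sequentially"
proof (induction rule: computes.induct)
  case (computes_Comp ys gs xs f z)
  have "eventually (\<lambda>t. \<forall>i\<in>{..<length gs}. bounded_eval (gs ! i) t xs = Suc (ys ! i)) sequentially"
    using computes_Comp.IH(1) by (subst eventually_ball_finite_distrib) auto
  then show ?case
    using computes_Comp.IH(2)
  proof eventually_elim
    case (elim t)
    then have "map (\<lambda>g. bounded_eval g t xs - 1) gs = ys"
      using computes_Comp.hyps by (auto intro: nth_equalityI)
    moreover have "\<forall>g\<in>set gs. bounded_eval g t xs \<noteq> 0"
      using elim(1) by (fastforce simp: in_set_conv_nth)
    ultimately show ?case using elim(2) by simp
  qed
next
  case (computes_PrimRec_Suc f g n xs r y)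
  from computes_PrimRec_Suc.IH show ?case
    by eventually_elim (simp cong: if_cong)
next
  case (computes_Mu f n xs)
  have "eventually (\<lambda>t. \<forall>i\<in>{..<n}. bounded_eval f t (i # xs) > 1) sequentially"
  proof (subst eventually_ball_finite_distrib, simp, intro ballI)
    fix i assume "i \<in> {..<n}"
    then obtain y where "y > 0" "eventually (\<lambda>t. bounded_eval f t (i # xs) = Suc y) sequentially"
      using computes_Mu.IH(2) by auto
    from this(2) show "eventually (\<lambda>t. bounded_eval f t (i # xs) > 1) sequentially"
      by eventually_elim (use \<open>y > 0\<close> in simp)
  qed
  \<comment> \<open>The bound must exceed \<open>n\<close>, or the search would be cut off before
    reaching the zero.\<close>
  then show ?case
    using computes_Mu.IH(1) eventually_gt_at_top[of n]
  proof eventually_elim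
    case (elim t)
    have "(LEAST n. t \<le> n \<or> bounded_eval f t (n # xs) \<le> 1) = n"
    proof (rule Least_equality)
      fix i assume "t \<le> i \<or> bounded_eval f t (i # xs) \<le> 1"
      then show "n \<le> i" using elim by (meson lessThan_iff less_le_trans linorder_not_le not_less_iff_gr_or_eq)
    qed (use elim in simp)
    then show ?case using elim by simp
  qed
qed auto

text \<open>As \<open>f\<close> is fixed, the evaluator unfolds along its structure. The arity is
  arbitrary in the induction because subterms receive argument lists of other lengths.\<close>

lemma recursive_bounded_eval: "recursive (Suc k) (\<lambda>ys. bounded_eval f (hd ys) (tl ys))"
proof (induction f arbitrary: k)
  case Zero
  show ?case by (simp add: recursive_const)
next
  case Succ
  show ?case
  proof (cases "k = 1")
    case True
    have "recursive (Suc k) (\<lambda>ys. Suc (Suc (ys ! 1)))"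
      using True by (intro recursive_intros) simp
    then show ?thesis
      by (rule recursive_cong) (use True in \<open>auto simp: nth_tl\<close>)
  next
    case False
    then show ?thesis by (intro recursive_cong[OF recursive_const[of _ 0]]) simp
  qed
next
  case (Proj i)
  show ?case
  proof (cases "i < k")
    case True
    have "recursive (Suc k) (\<lambda>ys. Suc (ys ! Suc i))"
      using True by (intro recursive_intros) simp
    then show ?thesis
      by (rule recursive_cong) (use True in \<open>auto simp: nth_tl\<close>)
  next
    case False
    then show ?thesis by (intro recursive_cong[OF recursive_const[of _ 0]]) simp
  qed
next
  case (Comp f gs)
  \<comment> \<open>Zero signals that all evaluations succeed, matching the zero test of
    \<open>recursive_if\<close>.\<close>
  have all: "recursive (Suc k)
      (\<lambda>ys. if \<forall>g\<in>set hs. bounded_eval g (hd ys) (tl ys) \<noteq> 0 then 0 else 1)"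
    if "set hs \<subseteq> set gs" for hs
    using that
  proof (induction hs)
    case Nil
    show ?case by (simp add: recursive_const)
  next
    case (Cons h hs)
    have "recursive (Suc k) (\<lambda>ys. if bounded_eval h (hd ys) (tl ys) = 0 then 1
        else if \<forall>g\<in>set hs. bounded_eval g (hd ys) (tl ys) \<noteq> 0 then 0 else 1)"
      using Cons Comp.IH(2) by (intro recursive_intros) auto
    then show ?case by (rule recursive_cong) auto
  qed
  \<comment> \<open>Taking \<open>hd\<close> and \<open>tl\<close> of an explicit list gives the
    shape of the induction hypothesis.\<close>
  have "recursive (Suc k) (\<lambda>ys. bounded_eval f
      (hd (hd ys # map (\<lambda>g. bounded_eval g (hd ys) (tl ys) - 1) gs))
      (tl (hd ys # map (\<lambda>g. bounded_eval g (hd ys) (tl ys) - 1) gs)))"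
  proof (rule recursive_compose[OF Comp.IH(1)])
    fix j assume j: "j < Suc (length gs)"
    show "recursive (Suc k) (\<lambda>ys. (hd ys # map (\<lambda>g. bounded_eval g (hd ys) (tl ys) - 1) gs) ! j)"
    proof (cases j)
      case 0
      then show ?thesis
        by (intro recursive_cong[OF recursive_nth[of 0]]) (auto simp: hd_conv_nth length_Suc_conv)
    next
      case (Suc i)
      then have "recursive (Suc k) (\<lambda>ys. bounded_eval (gs ! i) (hd ys) (tl ys) - 1)"
        using j Comp.IH(2) by (intro recursive_pred) simp
      then show ?thesis using j Suc by simp
    qed
  qed simp
  from recursive_if[OF all[OF subset_refl] this recursive_const[of _ 0]] show ?case
    by (rule recursive_cong) auto
next
  case (PrimRec f g)
  show ?case
  proof (cases k)
    case 0
    then show ?thesis by (intro recursive_cong[OF recursive_const[of _ 0]]) (auto simp: length_Suc_conv)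
  next
    case (Suc m)
    have "recursive (Suc k) (\<lambda>ys. bounded_eval f (hd (ys ! 0 # drop 2 ys)) (tl (ys ! 0 # drop 2 ys)))"
    proof (rule recursive_compose[OF PrimRec.IH(1)])
      fix j assume j: "j < Suc m"
      show "recursive (Suc k) (\<lambda>ys. (ys ! 0 # drop 2 ys) ! j)"
        by (rule recursive_cong[OF recursive_nth[of "if j = 0 then 0 else Suc j"]])
          (use j Suc in \<open>auto simp: nth_Cons'\<close>)
    qed (use Suc in simp)
    \<comment> \<open>The entries of \<open>zs\<close> are the counter, the previous value, the
      bound, the recursion variable and the remaining arguments.\<close>
    moreover have "recursive (Suc (Suc (Suc k))) (\<lambda>zs. if zs ! 1 = 0 then 0 else
       bounded_eval g (hd (zs ! 2 # zs ! 0 # (zs ! 1 - 1) # drop 4 zs))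
         (tl (zs ! 2 # zs ! 0 # (zs ! 1 - 1) # drop 4 zs)))"
    proof (intro recursive_if recursive_const recursive_nth recursive_compose[OF PrimRec.IH(2)])
      fix j assume j: "j < Suc (Suc (Suc m))"
      consider "j = 0" | "j = 1" | "j = 2" | i where "j = i + 3"
        by (metis One_nat_def Suc_1 add_2_eq_Suc' add_Suc_right numeral_3_eq_3 not0_implies_Suc)
      then show "recursive (Suc (Suc (Suc k))) (\<lambda>zs. (zs ! 2 # zs ! 0 # (zs ! 1 - 1) # drop 4 zs) ! j)"
      proof cases
        case (4 i)
        then show ?thesis
          by (intro recursive_cong[OF recursive_nth[of "i + 4"]])
            (use j Suc in \<open>auto simp: add.commute\<close>)
      qed (auto intro!: recursive_pred[unfolded One_nat_def] recursive_nth simp: Suc)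
    qed (use Suc in auto)
    ultimately have "recursive (Suc k) (\<lambda>ys. rec_nat (bounded_eval f (ys ! 0) (drop 2 ys))
        (\<lambda>i r. if r = 0 then 0 else bounded_eval g (ys ! 0) (i # (r - 1) # drop 2 ys)) (ys ! 1))"
      by (intro recursive_rec)
        (auto simp: Suc intro: recursive_nth recursive_cong)
    then show ?thesis
      by (rule recursive_cong) (auto simp: Suc length_Suc_conv cong: if_cong)
  qed
next
  case (Mu f)
  \<comment> \<open>In \<open>ys\<close> the search variable comes first, in the induction
    hypothesis the bound; the two are swapped.\<close>
  have v: "recursive (Suc (Suc k)) (\<lambda>ys. bounded_eval f
      (hd (ys ! 1 # ys ! 0 # drop 2 ys)) (tl (ys ! 1 # ys ! 0 # drop 2 ys)))"
  proof (rule recursive_compose[OF Mu.IH])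
    fix j assume j: "j < Suc (Suc k)"
    show "recursive (Suc (Suc k)) (\<lambda>ys. (ys ! 1 # ys ! 0 # drop 2 ys) ! j)"
      by (rule recursive_cong[OF recursive_nth[of "if j = 0 then 1 else if j = 1 then 0 else j"]])
        (use j in \<open>auto simp: nth_Cons' Suc_diff_Suc\<close>)
  qed simp
  \<comment> \<open>Truncated subtraction turns both stopping conditions into zero tests;
    \<open>n = t\<close> is a zero at the latest.\<close>
  let ?p = "\<lambda>ys. if ys ! 1 - ys ! 0 = 0 then 0 else bounded_eval f (ys ! 1) (ys ! 0 # drop 2 ys) - 1"
  have "recursive (Suc (Suc k)) ?p"
    using v by (intro recursive_intros) auto
  then have "recursive (Suc k) (\<lambda>ys. LEAST n. ?p (n # ys) = 0)"
    by (rule recursive_Least) (metis One_nat_def diff_self_eq_0 nth_Cons_0 nth_Cons_Suc)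
  then have n: "recursive (Suc k) (\<lambda>ys. LEAST n. hd ys \<le> n \<or> bounded_eval f (hd ys) (n # tl ys) \<le> 1)"
    (is "recursive _ ?n")
    by (rule recursive_cong) (auto simp: length_Suc_conv intro!: arg_cong[where f = Least])
  have w: "recursive (Suc k) (\<lambda>ys. bounded_eval f (hd (ys ! 0 # ?n ys # tl ys)) (tl (ys ! 0 # ?n ys # tl ys)))"
  proof (rule recursive_compose[OF Mu.IH])
    fix j assume j: "j < Suc (Suc k)"
    consider "j = 0" | "j = 1" | i where "j = i + 2"
      by (metis One_nat_def Suc_1 add_2_eq_Suc' not0_implies_Suc)
    then show "recursive (Suc k) (\<lambda>ys. (ys ! 0 # ?n ys # tl ys) ! j)"
    proof cases
      case (3 i)
      then show ?thesis
        by (intro recursive_cong[OF recursive_nth[of "Suc i"]]) (use j in \<open>auto simp: nth_tl\<close>)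
    qed (use n in \<open>auto intro!: recursive_nth\<close>)
  qed simp
  have "recursive (Suc k) (\<lambda>ys. if ys ! 0 - ?n ys = 0 then 0
      else if bounded_eval f (ys ! 0) (?n ys # tl ys) = 0 then 0
      else if bounded_eval f (ys ! 0) (?n ys # tl ys) - 1 = 0 then Suc (?n ys) else 0)"
    using w n by (intro recursive_intros) auto
  then show ?case
    by (rule recursive_cong) (auto simp: length_Suc_conv Let_def)
qed

section \<open>Self-reference\<close>

fun const_recf :: "nat \<Rightarrow> recf" where
  "const_recf 0 = Zero"
| "const_recf (Suc n) = Comp Succ [const_recf n]"

lemma computes_const_recf: "computes (const_recf n) xs n"
proof (induction n)
  case 0
  show ?case by (simp add: computes_Zero)
next
  case (Suc n)
  have "computes (Comp Succ [const_recf n]) xs (Suc n)"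
    by (rule computes_Comp[where ys = "[n]"]) (simp_all add: Suc computes_Succ)
  then show ?case by simp
qed

text \<open>This lets an algorithm write down a program with a given number hard-wired into
  it.\<close>

lemma recursive_encode_const_recf:
  assumes "recursive k f"
  shows "recursive k (\<lambda>xs. recf_encode (const_recf (f xs)))"
proof -
  \<comment> \<open>Since \<open>Suc (prod_encode (r, 0))\<close> is \<open>list_encode [r]\<close>,
    one step wraps the code \<open>r\<close> in \<open>Comp Succ\<close>.\<close>
  let ?step = "\<lambda>r. prod_encode (3, prod_encode (recf_encode Succ, Suc (prod_encode (r, 0))))"
  have "recursive k (\<lambda>xs. rec_nat (recf_encode Zero) (\<lambda>i r. ?step r) (f xs))"
    by (rule recursive_rec) (use assms in \<open>auto intro!: recursive_intros simp del: recf_encode.simps\<close>)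
  moreover have "rec_nat (recf_encode Zero) (\<lambda>i r. ?step r) n = recf_encode (const_recf n)" for n
    by (induction n) auto
  ultimately show ?thesis by simp
qed

text \<open>Kleene's recursion theorem for total \<open>h\<close>: a program that is handed its own
  code can compute the code of the composite doing the handing.\<close>

lemma computes_self_reference:
  assumes "recursive 2 h"
  obtains F where "\<And>n. computes F [n] (h [recf_encode F, n])"
proof -
  \<comment> \<open>If \<open>e\<close> is the code of \<open>E\<close>, this is the code of
    \<open>Comp E [const_recf e, Proj 0]\<close>.\<close>
  let ?d = "\<lambda>e. prod_encode (3, prod_encode (e,
    Suc (prod_encode (recf_encode (const_recf e), Suc (prod_encode (recf_encode (Proj 0), 0))))))"
  have d: "recursive 2 (\<lambda>xs. ?d (xs ! 0))"
    by (intro recursive_intros recursive_encode_const_recf) auto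
  have "recursive 2 (\<lambda>xs. h [?d (xs ! 0), xs ! 1])"
    by (rule recursive_compose[OF assms])
      (use d in \<open>auto simp: less_2_cases_iff intro!: recursive_nth simp del: recf_encode.simps\<close>)
  then obtain E where E: "\<And>xs. length xs = 2 \<Longrightarrow> computes E xs (h [?d (xs ! 0), xs ! 1])"
    by (auto simp: recursive_def)
  let ?F = "Comp E [const_recf (recf_encode E), Proj 0]"
  have "computes ?F [n] (h [recf_encode ?F, n])" for n
  proof (rule computes_Comp[where ys = "[recf_encode E, n]"])
    show "computes E [recf_encode E, n] (h [recf_encode ?F, n])"
      using E[of "[recf_encode E, n]"] by simp
    have "computes (Proj 0) [n] ([n] ! 0)" by (rule computes_Proj) simp
    then show "\<forall>i<length [const_recf (recf_encode E), Proj 0].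
        computes ([const_recf (recf_encode E), Proj 0] ! i) [n] ([recf_encode E, n] ! i)"
      by (auto simp: computes_const_recf nth_Cons')
  qed simp
  then show ?thesis by (rule that)
qed

section \<open>Problems with one variable and one equation\<close>

text \<open>The fraction is in lowest terms and \<open>int_encode 1 = 2\<close>; so pairing alone
  suffices to output reciprocals.\<close>

lemma rat_encode_reciprocal: "rat_encode (1 / of_nat (Suc n)) = prod_encode (2, Suc n)"
proof -
  have "(1 / of_nat (Suc n) :: rat) = Fract 1 (int (Suc n))"
    by (simp add: Fract_of_int_quotient)
  then have "quotient_of (1 / of_nat (Suc n)) = (1, int (Suc n))"
    by (simp add: quotient_of_Fract normalize_def)
  then show ?thesis
    by (simp add: rat_encode_def int_encode_def sum_encode_def nat_add_distrib del: of_nat_Suc)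
qed

text \<open>The code dominates the denominator \<open>b\<close>, and \<open>b * \<epsilon>\<close>
  is the positive numerator. Indices can thus be read off the code of \<open>\<epsilon>\<close>
  without decoding it.\<close>

lemma one_le_rat_encode_mult:
  assumes "\<epsilon> > 0"
  shows "1 \<le> of_nat (rat_encode \<epsilon>) * \<epsilon>"
proof -
  obtain a b where ab: "quotient_of \<epsilon> = (a, b)" by fastforce
  have b: "b > 0" using ab quotient_of_denom_pos by blast
  have eps: "\<epsilon> = of_int a / of_int b" using ab quotient_of_div by blast
  then have "a \<ge> 1" using assms b by (simp add: zero_less_divide_iff)
  have "nat b \<le> rat_encode \<epsilon>"
    by (simp add: rat_encode_def ab le_prod_encode_2)
  then have "of_int b \<le> (of_nat (rat_encode \<epsilon>) :: rat)"
    using b by (metis of_int_le_iff of_int_of_nat_eq nat_le_iff)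
  then have "of_int b * \<epsilon> \<le> of_nat (rat_encode \<epsilon>) * \<epsilon>"
    using assms by (intro mult_right_mono) auto
  moreover have "of_int b * \<epsilon> = of_int a" using eps b by simp
  ultimately show ?thesis using \<open>a \<ge> 1\<close> by (metis of_int_1_le_iff order_trans)
qed

text \<open>The factor \<open>k\<close> gives the modulus \<open>k * rat_encode \<epsilon>\<close>
  for the sequence \<open>k / (n + 1)\<close>.\<close>

lemma reciprocal_less:
  assumes "\<epsilon> > 0" "k * rat_encode \<epsilon> < Suc n"
  shows "of_nat k / of_nat (Suc n) < \<epsilon>"
proof -
  have "of_nat k * 1 \<le> of_nat k * (of_nat (rat_encode \<epsilon>) * \<epsilon>)"
    using one_le_rat_encode_mult[OF assms(1)] by (intro mult_left_mono) auto
  also have "\<dots> = of_nat (k * rat_encode \<epsilon>) * \<epsilon>" by simp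
  also have "\<dots> < of_nat (Suc n) * \<epsilon>"
    using assms by (intro mult_strict_right_mono) (simp_all only: of_nat_less_iff)
  finally show ?thesis
    by (simp add: divide_less_eq mult.commute del: of_nat_Suc)
qed

section \<open>Constant and reciprocal sequences as constructive reals\<close>

lemma computes_Proj_0: "computes (Proj 0) [n] n"
  using computes_Proj[of 0 "[n]"] by simp

definition const_crn :: "rat \<Rightarrow> crn" where
  "const_crn q = (const_recf (rat_encode q), Zero)"

lemma approx_const_crn [simp]: "approx (const_crn q) n = q"
  by (rule approx_eqI) (simp add: const_crn_def computes_const_recf)

lemma approx_const_crn_eq: "approx (const_crn q) = (\<lambda>_. q)"
  by (rule ext) simp

lemma is_crn_const_crn [simp]: "is_crn (const_crn q)"
proof -
  have "\<exists>q'. computes (fst (const_crn q)) [n] (rat_encode q')" for n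
    by (auto simp: const_crn_def intro: computes_const_recf)
  moreover have "computes (snd (const_crn q)) xs 0" for xs
    by (auto simp: const_crn_def intro: computes_Zero)
  ultimately show ?thesis
    unfolding is_crn_def by (metis approx_const_crn abs_zero diff_self)
qed

lemma recursive_crn:
  assumes "recursive 1 (\<lambda>xs. s (xs ! 0))"
  obtains F where "\<And>n. computes F [n] (rat_encode (1 / of_nat (Suc (s n))))"
proof -
  have "recursive 1 (\<lambda>xs. prod_encode (2, Suc (s (xs ! 0))))"
    using assms by (intro recursive_intros)
  then obtain F where F: "\<And>xs. length xs = 1 \<Longrightarrow> computes F xs (prod_encode (2, Suc (s (xs ! 0))))"
    by (auto simp: recursive_def)
  show ?thesis
    by (rule that[of F]) (use F[of "[_]"] in \<open>simp add: rat_encode_reciprocal del: of_nat_Suc\<close>)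
qed

text \<open>The identity serves as a regulator because \<open>rat_encode \<epsilon> \<ge> 1 / \<epsilon>\<close>.\<close>

lemma is_crn_reciprocal:
  assumes F: "\<And>n. computes F [n] (rat_encode (1 / of_nat (Suc (s n))))"
    and s: "\<And>m n N. N < m \<Longrightarrow> N < n \<Longrightarrow> s m = s n \<or> N < s m \<and> N < s n"
  shows "is_crn (F, Proj 0)"
proof -
  have ap: "approx (F, Proj 0) n = 1 / of_nat (Suc (s n))" for n
    using F by (intro approx_eqI) simp
  have "\<bar>approx (F, Proj 0) m - approx (F, Proj 0) n\<bar> < \<epsilon>"
    if "\<epsilon> > 0" "rat_encode \<epsilon> < m" "rat_encode \<epsilon> < n" for \<epsilon> m n
  proof (cases "s m = s n")
    case True
    then show ?thesis using that by (simp add: ap)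
  next
    case False
    \<comment> \<open>Both reciprocals lie strictly between 0 and \<open>\<epsilon>\<close>, hence
      so close together.\<close>
    then have "rat_encode \<epsilon> < s m" "rat_encode \<epsilon> < s n" using s that by blast+
    then have "1 / of_nat (Suc (s m)) < \<epsilon>" "1 / of_nat (Suc (s n)) < \<epsilon>"
      using reciprocal_less[of \<epsilon> 1] that by auto
    moreover have "0 < (1 :: rat) / of_nat (Suc (s m))" "0 < (1 :: rat) / of_nat (Suc (s n))"
      by (simp_all del: of_nat_Suc)
    ultimately show ?thesis unfolding ap by linarith
  qed
  then show ?thesis
    using F computes_Proj_0 unfolding is_crn_def by (metis fst_conv snd_conv)
qed

text \<open>A representative of zero with strictly positive approximations; it serves as allowable
  plan and, for nonzero coefficient, as optimal plan.\<close>

lemma ex_reciprocal_crn: "\<exists>y. is_crn y \<and> (\<forall>n. approx y n = 1 / of_nat (Suc n))"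
proof -
  have "recursive 1 (\<lambda>xs. xs ! 0)" by (rule recursive_nth) simp
  then obtain F where F: "\<And>n. computes F [n] (rat_encode (1 / of_nat (Suc n)))"
    by (rule recursive_crn) blast
  have "is_crn (F, Proj 0)" by (rule is_crn_reciprocal[OF F]) auto
  moreover have "approx (F, Proj 0) n = 1 / of_nat (Suc n)" for n
    using F by (intro approx_eqI) simp
  ultimately show ?thesis by blast
qed

section \<open>The problem attached to a constructive real\<close>

definition problem :: "crn \<Rightarrow> clpp" where
  "problem x = CLPP Maximize [const_crn 1] [([x], Equal, const_crn 0)]"

lemma is_clpp_problem: "is_crn x \<Longrightarrow> is_clpp (problem x)"
  by (simp add: is_clpp_def problem_def)

lemma allowable_problem:
  "allowable (problem x) p \<longleftrightarrow>
    (\<exists>y. p = [y] \<and> is_crn y \<and> crn_eq (\<lambda>n. approx x n * approx y n) (\<lambda>_. 0))"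
  by (auto simp: allowable_def is_plan_def problem_def linear_form_def length_Suc_conv
      approx_const_crn_eq)

lemma cost_problem: "linear_form (cost (problem x)) [y] = approx y"
  by (simp add: problem_def linear_form_def)

lemma objective_problem: "objective (problem x) = Maximize"
  by (simp add: problem_def)

text \<open>With the regulator fixed as \<open>Proj 0\<close>, only the code of \<open>F\<close>
  varies; \<open>Suc (prod_encode (_, 0))\<close> encodes a singleton list.\<close>

lemma recursive_encode_problem:
  obtains h where "recursive 1 h" "\<And>F. h [recf_encode F] = clpp_encode (problem (F, Proj 0))"
proof
  show "recursive 1 (\<lambda>xs. prod_encode (objective_encode Maximize,
      prod_encode (list_encode (map crn_encode [const_crn 1]),
        Suc (prod_encode (prod_encode (Suc (prod_encode (prod_encode (xs ! 0, recf_encode (Proj 0)), 0)),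
          prod_encode (comparison_encode Equal, crn_encode (const_crn 0))), 0)))))"
    by (intro recursive_intros) simp
qed (simp add: problem_def)

text \<open>One index \<open>M\<close> works for every \<open>\<epsilon>\<close>, so a constant
  algorithm produces it.\<close>

lemma crn_leI:
  assumes "\<And>m n. M < m \<Longrightarrow> M < n \<Longrightarrow> x n \<le> y m"
  shows "crn_le x y"
proof -
  have "x n - \<epsilon> < y m" if "0 < \<epsilon>" "M < m" "M < n" for \<epsilon> m n
    using assms[OF that(2,3)] that(1) by linarith
  then show ?thesis
    unfolding crn_le_def using computes_const_recf[of M] by blast
qed

lemma crn_leD:
  assumes "crn_le x y" "\<epsilon> > 0"
  obtains M where "\<And>m n. M < m \<Longrightarrow> M < n \<Longrightarrow> x n - \<epsilon> < y m"
  using assms unfolding crn_le_def by meson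

lemma crn_eqD:
  assumes "crn_eq x y" "\<epsilon> > 0"
  obtains M where "\<And>m n. M < m \<Longrightarrow> M < n \<Longrightarrow> \<bar>x m - y n\<bar> < \<epsilon>"
  using assms unfolding crn_eq_def by meson

lemma is_crnD:
  assumes "is_crn x" "\<epsilon> > 0"
  obtains N where "computes (snd x) [rat_encode \<epsilon>] N"
    "\<And>m n. N < m \<Longrightarrow> N < n \<Longrightarrow> \<bar>approx x m - approx x n\<bar> < \<epsilon>"
  using assms unfolding is_crn_def by meson

text \<open>The products are at most \<open>1 / (n + 1)\<close>, so the plan is allowable whether or
  not \<open>x\<close> is zero.\<close>

lemma allowable_reciprocal:
  assumes x: "\<forall>n. 0 \<le> approx x n \<and> approx x n \<le> 1"
    and y: "is_crn y" "\<And>n. approx y n = 1 / of_nat (Suc n)"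
  shows "allowable (problem x) [y]"
proof -
  have "\<bar>approx x m * approx y m - 0\<bar> < \<epsilon>" if "\<epsilon> > 0" "rat_encode \<epsilon> < m" for \<epsilon> m
  proof -
    have "approx x m * approx y m \<le> 1 * approx y m"
      using x by (intro mult_right_mono) (auto simp: y)
    also have "\<dots> < \<epsilon>" using reciprocal_less[of \<epsilon> 1 m] that y by simp
    finally show ?thesis using x by (simp add: y)
  qed
  then have "crn_eq (\<lambda>n. approx x n * approx y n) (\<lambda>_. 0)"
    unfolding crn_eq_def using computes_Proj_0 by blast
  then show ?thesis using y by (auto simp: allowable_problem)
qed

text \<open>Eventually the product is \<open>c * approx y n\<close>; the tolerance
  \<open>c * \<epsilon>\<close> lets \<open>c\<close> cancel.\<close>

lemma plan_tendsto_0: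
  assumes x: "c > 0" "\<forall>n>K. approx x n = c"
    and y: "allowable (problem x) [y]" and "\<epsilon> > 0"
  obtains M where "\<And>n. M < n \<Longrightarrow> \<bar>approx y n\<bar> < \<epsilon>"
proof -
  have "crn_eq (\<lambda>n. approx x n * approx y n) (\<lambda>_. 0)" "c * \<epsilon> > 0"
    using y assms by (auto simp: allowable_problem)
  then obtain M where M: "\<And>m n. M < m \<Longrightarrow> M < n \<Longrightarrow> \<bar>approx x m * approx y m - 0\<bar> < c * \<epsilon>"
    by (rule crn_eqD) blast
  have "\<bar>approx y n\<bar> < \<epsilon>" if "max M K < n" for n
  proof -
    have "\<bar>c * approx y n\<bar> < c * \<epsilon>" using M[of n n] x(2) that by simp
    then show ?thesis using x(1) by (simp add: abs_mult)
  qed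
  then show ?thesis by (rule that)
qed

lemma problem_nonzero:
  assumes x: "\<forall>n. 0 \<le> approx x n \<and> approx x n \<le> 1"
    and c: "c > 0" "\<forall>n>K. approx x n = c"
  shows "plans_bounded (problem x)" "cost_bounded (problem x)" "has_optimal_plan (problem x)"
proof -
  have le: "crn_le (\<lambda>n. \<bar>approx y n\<bar>) (\<lambda>_. 1) \<and> crn_le (approx y) (\<lambda>_. 1)"
    if y: "allowable (problem x) [y]" for y
  proof -
    obtain M where M: "\<And>n. M < n \<Longrightarrow> \<bar>approx y n\<bar> < 1"
      using plan_tendsto_0[OF c y zero_less_one] by blast
    show ?thesis
      by (intro conjI crn_leI[of M]) (use M in \<open>force simp: abs_less_iff\<close>)+
  qed
  show "plans_bounded (problem x)"
    unfolding plans_bounded_def using le by (intro exI[of _ 1]) (auto simp: allowable_problem)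
  show "cost_bounded (problem x)"
    unfolding cost_bounded_def objective_problem
    using le by (intro exI[of _ 1]) (auto simp: allowable_problem cost_problem)
  obtain z where z: "is_crn z" "\<And>n. approx z n = 1 / of_nat (Suc n)"
    using ex_reciprocal_crn by blast
  have "crn_le (approx y) (approx z)" if y: "allowable (problem x) [y]" for y
  proof -
    have "is_crn y" using y by (auto simp: allowable_problem)
    \<comment> \<open>That \<open>y\<close> tends to 0 is not enough: the order demands an algorithm
      for the index, and the regulator of \<open>y\<close> provides one.\<close>
    have "\<exists>M. computes (snd y) [rat_encode \<epsilon>] M \<and> (\<forall>m>M. \<forall>n>M. approx z m > approx y n - \<epsilon>)"
      if eps: "\<epsilon> > 0" for \<epsilon>
    proof -
      obtain N where N: "computes (snd y) [rat_encode \<epsilon>] N"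
        "\<And>m n. N < m \<Longrightarrow> N < n \<Longrightarrow> \<bar>approx y m - approx y n\<bar> < \<epsilon>"
        using is_crnD[OF \<open>is_crn y\<close> eps] by blast
      have "approx z m > approx y n - \<epsilon>" if mn: "N < m" "N < n" for m n
      proof (rule ccontr)
        \<comment> \<open>The regulator only yields the nonstrict \<open>lim y \<ge> y n - \<epsilon>\<close>; positivity of \<open>z\<close> makes up for it.\<close>
        assume "\<not> ?thesis"
        then have pos: "approx z m \<le> approx y n - \<epsilon>" by simp
        have "0 < approx z m" by (simp add: z del: of_nat_Suc)
        then obtain M where M: "\<And>i. M < i \<Longrightarrow> \<bar>approx y i\<bar> < approx z m"
          using plan_tendsto_0[OF c y] by blast
        have "\<bar>approx y (Suc (max M N))\<bar> < approx z m"
          "\<bar>approx y (Suc (max M N)) - approx y n\<bar> < \<epsilon>"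
          using M N(2) mn by auto
        then show False using pos by linarith
      qed
      then show ?thesis using N(1) by blast
    qed
    then show ?thesis unfolding crn_le_def by blast
  qed
  then have "optimal (problem x) [z]"
    unfolding optimal_def objective_problem
    using allowable_reciprocal[OF x z] by (auto simp: cost_problem allowable_problem)
  then show "has_optimal_plan (problem x)" unfolding has_optimal_plan_def by blast
qed

text \<open>Every natural number is an allowable plan because \<open>k / (n + 1)\<close> tends to 0;
  no bound and no optimal plan can dominate them all.\<close>

lemma problem_zero:
  assumes x: "\<forall>n. approx x n = 1 / of_nat (Suc n)"
  shows "\<not> plans_bounded (problem x)" "\<not> cost_bounded (problem x)"
    "\<not> has_optimal_plan (problem x)"
proof -
  have allow: "allowable (problem x) [const_crn (of_nat k)]" for k
  proof -
    \<comment> \<open>Multiplication by the fixed \<open>k\<close> is repeated addition; it yields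
      the modulus for \<open>k / (n + 1)\<close>.\<close>
    have "recursive 1 (\<lambda>xs. k * xs ! 0)"
      by (induction k) (auto intro: recursive_intros)
    then obtain A where A: "\<And>n. computes A [n] (k * n)"
      unfolding recursive_def by (metis One_nat_def length_Cons list.size(3) nth_Cons_0)
    have "\<bar>approx x m * of_nat k - 0\<bar> < \<epsilon>" if "\<epsilon> > 0" "k * rat_encode \<epsilon> < m" for \<epsilon> m
      using reciprocal_less[of \<epsilon> k m] that by (simp add: x)
    then have "crn_eq (\<lambda>n. approx x n * of_nat k) (\<lambda>_. 0)"
      unfolding crn_eq_def using A by blast
    then show ?thesis by (simp add: allowable_problem)
  qed
  \<comment> \<open>Applied below both to constant bounds and to the approximations of a supposed
    optimal plan.\<close>
  have not_le: "\<exists>k. \<not> crn_le (\<lambda>_. of_nat k) z"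
    if bound: "\<And>n. N < n \<Longrightarrow> z n \<le> B" for z :: "nat \<Rightarrow> rat" and B N
  proof -
    \<comment> \<open>The margin 1 absorbs the tolerance 1 used next.\<close>
    obtain k where k: "B + 1 < of_nat k" using reals_Archimedean2 by blast
    have False if le: "crn_le (\<lambda>_. of_nat k) z"
    proof -
      obtain M where "\<And>m n. M < m \<Longrightarrow> M < n \<Longrightarrow> of_nat k - 1 < z m"
        using crn_leD[OF le zero_less_one] by blast
      from this[of "Suc (max M N)" "Suc M"] bound[of "Suc (max M N)"] k
      show False by (simp add: less_Suc_eq_le)
    qed
    then show ?thesis by blast
  qed
  show "\<not> plans_bounded (problem x)"
  proof
    assume "plans_bounded (problem x)"
    then obtain B where B: "\<And>y. allowable (problem x) [y] \<Longrightarrow> crn_le (\<lambda>n. \<bar>approx y n\<bar>) (\<lambda>_. B)"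
      unfolding plans_bounded_def by (metis list.set_intros(1))
    then have "crn_le (\<lambda>_. of_nat k) (\<lambda>_. B)" for k using B[OF allow[of k]] by simp
    then show False using not_le[of 0 "\<lambda>_. B" B] by blast
  qed
  show "\<not> cost_bounded (problem x)"
  proof
    assume "cost_bounded (problem x)"
    then obtain B where B: "\<And>y. allowable (problem x) [y] \<Longrightarrow> crn_le (approx y) (\<lambda>_. B)"
      unfolding cost_bounded_def objective_problem objective.case by (metis cost_problem)
    then have "crn_le (\<lambda>_. of_nat k) (\<lambda>_. B)" for k
      using B[OF allow[of k]] by (simp add: approx_const_crn_eq)
    then show False using not_le[of 0 "\<lambda>_. B" B] by blast
  qed
  show "\<not> has_optimal_plan (problem x)"
  proof
    assume "has_optimal_plan (problem x)"
    then obtain p where p: "optimal (problem x) p"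
      unfolding has_optimal_plan_def by blast
    then obtain z where pz: "p = [z]" and z: "is_crn z"
      unfolding optimal_def allowable_problem by blast
    have opt: "crn_le (approx y) (approx z)" if "allowable (problem x) [y]" for y
      using p that unfolding optimal_def pz objective_problem objective.case by (metis cost_problem)
    obtain N where N: "\<And>m n. N < m \<Longrightarrow> N < n \<Longrightarrow> \<bar>approx z m - approx z n\<bar> < 1"
      using is_crnD[OF z zero_less_one] by blast
    have "approx z n \<le> approx z (Suc N) + 1" if "N < n" for n
      using N[of n "Suc N"] that by (simp add: abs_less_iff)
    then obtain k where "\<not> crn_le (\<lambda>_. of_nat k) (approx z)"
      using not_le by blast
    then show False using opt[OF allow[of k]] by (simp add: approx_const_crn_eq)
  qed
qed

section \<open>Undecidability\<close>

text \<open>Treats the three questions at once: the diagonal argument needs \<open>Q\<close> only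
  for the two kinds of approximating sequence that the self-referential \<open>x\<close> can
  have.\<close>

lemma undecidable:
  assumes zero: "\<And>x. \<forall>n. approx x n = 1 / of_nat (Suc n) \<Longrightarrow> \<not> Q (problem x)"
    and nonzero: "\<And>x c K. \<forall>n. 0 \<le> approx x n \<and> approx x n \<le> 1 \<Longrightarrow> c > 0 \<Longrightarrow>
      \<forall>n>K. approx x n = c \<Longrightarrow> Q (problem x)"
  shows "\<nexists>D. decides D Q"
proof
  assume "\<exists>D. decides D Q"
  then obtain D where D: "decides D Q" by blast
  obtain h where h: "recursive 1 h" "\<And>F. h [recf_encode F] = clpp_encode (problem (F, Proj 0))"
    by (rule recursive_encode_problem) blast
  \<comment> \<open>The value 1 of \<open>bounded_eval\<close> means that \<open>D\<close> has
    returned 0.\<close>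
  let ?T = "\<lambda>n t e. n \<le> t \<or> bounded_eval D t [h [e]] = 1"
  let ?s = "\<lambda>e n. LEAST t. ?T n t e"
  have "recursive (Suc 2) (\<lambda>ys. h [ys ! 1])"
    by (rule recursive_compose[OF h(1)]) (auto intro!: recursive_nth)
  then have "recursive (Suc 2) (\<lambda>ys. bounded_eval D (hd [ys ! 0, h [ys ! 1]]) (tl [ys ! 0, h [ys ! 1]]))"
    by (intro recursive_compose[OF recursive_bounded_eval[of 1 D]])
      (auto simp: less_Suc_eq intro!: recursive_nth)
  \<comment> \<open>A missing result (0) is sent to 1, since truncated subtraction alone would
    confuse it with the result 0.\<close>
  then have "recursive (Suc 2) (\<lambda>ys. if ys ! 2 - ys ! 0 = 0 then 0 else
      if bounded_eval D (ys ! 0) [h [ys ! 1]] = 0 then 1 else bounded_eval D (ys ! 0) [h [ys ! 1]] - 1)"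
    (is "recursive _ ?p")
    by (intro recursive_intros) simp_all
  then have "recursive 2 (\<lambda>ys. LEAST t. ?p (t # ys) = 0)"
    by (rule recursive_Least) (metis diff_self_eq_0 nth_Cons_0 nth_Cons_numeral)
  then have "recursive 2 (\<lambda>ys. ?s (ys ! 0) (ys ! 1))"
    by (rule recursive_cong) (auto simp: numeral_2_eq_2 length_Suc_conv intro!: arg_cong[where f = Least])
  then have "recursive 2 (\<lambda>ys. prod_encode (2, Suc (?s (ys ! 0) (ys ! 1))))"
    by (intro recursive_intros)
  \<comment> \<open>Here the parameter \<open>e\<close> becomes the code of \<open>F\<close>
    itself.\<close>
  then obtain F where "\<And>n. computes F [n] (prod_encode (2, Suc (?s ([recf_encode F, n] ! 0) ([recf_encode F, n] ! 1))))"
    by (rule computes_self_reference) blast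
  then have F: "computes F [n] (rat_encode (1 / of_nat (Suc (?s (recf_encode F) n))))" for n
    by (simp add: rat_encode_reciprocal del: of_nat_Suc)
  define x where "x = (F, Proj 0)"
  define s where "s n = (LEAST t. n \<le> t \<or> bounded_eval D t [clpp_encode (problem x)] = 1)" for n
  have F: "computes F [n] (rat_encode (1 / of_nat (Suc (s n))))" for n
    using F[of n] by (simp only: h(2) x_def s_def)
  have ap: "approx x n = 1 / of_nat (Suc (s n))" for n
    using F by (intro approx_eqI) (simp add: x_def)
  have x01: "\<forall>n. 0 \<le> approx x n \<and> approx x n \<le> 1"
    by (simp_all add: ap)
  have s_stop: "n \<le> s n \<or> bounded_eval D (s n) [clpp_encode (problem x)] = 1" for n
    unfolding s_def by (rule LeastI[of _ n]) simp
  have s_le: "s n \<le> t" if "n \<le> t \<or> bounded_eval D t [clpp_encode (problem x)] = 1" for n t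
    unfolding s_def using that by (rule Least_le)
  have "is_crn x"
    unfolding x_def
  proof (rule is_crn_reciprocal[OF F])
    fix m n N :: nat assume "N < m" "N < n"
    \<comment> \<open>A stage at most \<open>N\<close> is below \<open>m\<close> and
      \<open>n\<close>, so \<open>D\<close> has really returned 0 there, and both searches stop at
      the first such stage.\<close>
    have "s m = s n" if "s m \<le> N \<or> s n \<le> N"
      using that \<open>N < m\<close> \<open>N < n\<close> s_stop[of m] s_stop[of n] s_le[of m "s n"] s_le[of n "s m"]
      by linarith
    then show "s m = s n \<or> N < s m \<and> N < s n" by linarith
  qed
  moreover have "plans_nonempty (problem x)"
    unfolding plans_nonempty_def using ex_reciprocal_crn allowable_reciprocal[of x] x01 by blast
  ultimately have out: "computes D [clpp_encode (problem x)] (if Q (problem x) then 1 else 0)"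
    using D is_clpp_problem unfolding decides_def by blast
  show False
  proof (cases "Q (problem x)")
    case True
    \<comment> \<open>As \<open>D\<close> returns 1, no stage shows the result 0; every search runs
      to \<open>n\<close>, and \<open>x\<close> represents zero.\<close>
    have "bounded_eval D t [clpp_encode (problem x)] \<noteq> 1" for t
      using bounded_eval_sound[of D t "[clpp_encode (problem x)]" 0] out True
      by (auto dest: computes_deterministic)
    then have "s n = n" for n using s_stop[of n] s_le[of n n] by auto
    then show False using zero[of x] ap True by simp
  next
    case False
    then have "eventually (\<lambda>t. bounded_eval D t [clpp_encode (problem x)] = 1) sequentially"
      using bounded_eval_complete[OF out] by simp
    then obtain t where t: "bounded_eval D t [clpp_encode (problem x)] = 1"
      by (auto simp: eventually_sequentially)
    \<comment> \<open>Beyond \<open>t\<close> the limit \<open>n\<close> has no effect, so all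
      searches stop at the same stage and \<open>x\<close> is eventually a positive
      constant.\<close>
    have "s n = s (Suc t)" if "t < n" for n
      using that s_stop[of n] s_stop[of "Suc t"] s_le[of n t] s_le[of "Suc t" t]
        s_le[of n "s (Suc t)"] s_le[of "Suc t" "s n"] t by linarith
    then have "approx x n = 1 / of_nat (Suc (s (Suc t)))" if "t < n" for n
      using that by (metis ap)
    then show False
      using nonzero[of x "1 / of_nat (Suc (s (Suc t)))" t] x01 False by (simp del: of_nat_Suc)
  qed
qed

theorem theorem8:
  "(\<nexists>D. decides D plans_bounded) \<and>
   (\<nexists>D. decides D cost_bounded) \<and>
   (\<nexists>D. decides D has_optimal_plan)"
  by (intro conjI; rule undecidable; (rule problem_zero | rule problem_nonzero); assumption)

end
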